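(* Let $P\subseteq\mathbb{R}^n$ be a polyhedron and let $f:\mathbb{R}^n\to\mathbb{R}$ be a polynomial of degree at most three. If $f$ is unbounded on $P$, then there exists a ray of $P$ on which $f$ is unbounded.
   Context: For a polyhedron $P\subseteq\mathbb{R}^n$ with recession cone $\operatorname{rec} P$, a ray of $P$ is a set $R(x,d):=\{x+\lambda d:\lambda\ge 0\}$ with $x\in P$ and $d\in\operatorname{rec}P\setminus\{0\}$. A function $f$ is unbounded on a set $S$ if $\sup_{x\in S}f(x)=+\infty$. *)

theory Defs
  imports "HOL-Analysis.Analysis"
begin

definition poly_deg_le3 :: "(real ^ 'n \<Rightarrow> real) \<Rightarrow> bool" where
  "poly_deg_le3 f \<longleftrightarrow>
     (\<exists>(c::real) (b::'n \<Rightarrow> real) (A::'n \<Rightarrow> 'n \<Rightarrow> real) (T::'n \<Rightarrow> 'n \<Rightarrow> 'n \<Rightarrow> real).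
        \<forall>x. f x = c + (\<Sum>i\<in>UNIV. b i * x $ i)
                   + (\<Sum>i\<in>UNIV. \<Sum>j\<in>UNIV. A i j * x $ i * x $ j)
                   + (\<Sum>i\<in>UNIV. \<Sum>j\<in>UNIV. \<Sum>k\<in>UNIV. T i j k * x $ i * x $ j * x $ k))"

definition rec_cone :: "'a::real_vector set \<Rightarrow> 'a set" where
  "rec_cone P = {d. \<forall>x\<in>P. \<forall>t::real. t \<ge> 0 \<longrightarrow> x + t *\<^sub>R d \<in> P}"

definition ray :: "'a::real_vector \<Rightarrow> 'a \<Rightarrow> 'a set" where
  "ray x d = {x + t *\<^sub>R d | t::real. t \<ge> 0}"

definition unbounded_on :: "('a \<Rightarrow> real) \<Rightarrow> 'a set \<Rightarrow> bool" where
  "unbounded_on f S \<longleftrightarrow> (\<forall>M. \<exists>x\<in>S. f x > M)"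

end

theory Submission
  imports Defs "HOL-Real_Asymp.Real_Asymp"
begin

text \<open>
Suppose \<open>f\<close> is bounded above on every ray but not on \<open>P\<close>. Among the points of \<open>P\<close> where \<open>f\<close> is
at least a large level take one, \<open>x\<^sub>n\<close>, of least norm; then \<open>x\<^sub>n\<close> tends to infinity, and along
a subsequence in some direction \<open>d\<close> of the recession cone. Write \<open>f x = F (x,1) (x,1) (x,1)\<close> with
\<open>F\<close> symmetric trilinear, and identify \<open>d\<close> with \<open>(d,0)\<close>. Positivity of \<open>f x\<^sub>n\<close> forces \<open>F d d d = 0\<close>.
On the homogenized cone \<open>K\<close> of \<open>P\<close>, boundedness on rays gives \<open>F d d z \<le> 0\<close>, and \<open>F d z z \<le> 0\<close>
wherever \<open>F d d z = 0\<close>. By a Hoffman error bound, \<open>z \<in> K\<close> is within \<open>O(\<bar>F d d z\<bar>)\<close> of the subcone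
\<open>F d d z = 0\<close>, so \<open>F d z z \<le> C * \<bar>z\<bar> * \<bar>F d d z\<bar>\<close>. Hence the quadratic term dominates the linear one:
moving from \<open>y \<in> P\<close> by \<open>t\<close> along \<open>d\<close> does not increase \<open>f\<close> once \<open>t \<ge> C * \<bar>(y,1)\<bar>\<close>. This applies to
\<open>y = x\<^sub>n - (1 - e) \<bar>x\<^sub>n\<bar> d\<close>, which lies in \<open>P\<close> for large \<open>n\<close>, is shorter than \<open>x\<^sub>n\<close> and
therefore has \<open>f y < f x\<^sub>n\<close>: a contradiction.
\<close>

section \<open>Cubics in one variable that are bounded above on a half-line\<close>

text \<open>The highest nonvanishing coefficient among \<open>a3\<close>, \<open>a2\<close>,
  \<open>a1\<close> decides the limit at infinity; were it positive, the cubic would exceed every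
  bound.\<close>

lemma cubic_bounded_above_coeffs:
  fixes a0 a1 a2 a3 :: real
  assumes bd: "\<And>t. t \<ge> 0 \<Longrightarrow> a0 + a1 * t + a2 * t^2 + a3 * t^3 \<le> M"
  shows "a3 \<le> 0" "a3 = 0 \<Longrightarrow> a2 \<le> 0" "a3 = 0 \<Longrightarrow> a2 = 0 \<Longrightarrow> a1 \<le> 0"
proof -
  have not_top: "\<not> filterlim (\<lambda>t. a0 + a1 * t + a2 * t^2 + a3 * t^3) at_top at_top"
  proof
    assume "filterlim (\<lambda>t. a0 + a1 * t + a2 * t^2 + a3 * t^3) at_top at_top"
    then have "\<forall>\<^sub>F t in at_top. M < a0 + a1 * t + a2 * t^2 + a3 * t^3"
      by (simp add: filterlim_at_top_dense)
    then have "\<forall>\<^sub>F t::real in at_top. False"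
      using eventually_ge_at_top[of 0] by eventually_elim (use bd in \<open>simp add: not_less[symmetric]\<close>)
    then show False by simp
  qed
  show "a3 \<le> 0"
  proof (rule ccontr)
    assume "\<not> a3 \<le> 0"
    then have "a3 > 0" by simp
    then have "filterlim (\<lambda>t. a0 + a1 * t + a2 * t^2 + a3 * t^3) at_top at_top" by real_asymp
    then show False using not_top by simp
  qed
  show "a2 \<le> 0" if "a3 = 0"
  proof (rule ccontr)
    assume "\<not> a2 \<le> 0"
    then have "a2 > 0" by simp
    then have "filterlim (\<lambda>t. a0 + a1 * t + a2 * t^2) at_top at_top" by real_asymp
    then show False using not_top that by simp
  qed
  show "a1 \<le> 0" if "a3 = 0" "a2 = 0"
  proof (rule ccontr)
    assume "\<not> a1 \<le> 0"
    then have "a1 > 0" by simp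
    then have "filterlim (\<lambda>t. a0 + a1 * t) at_top at_top" by real_asymp
    then show False using not_top that by simp
  qed
qed

section \<open>Hoffman error bound for the zero set of a linear form on a polyhedral cone\<close>

text \<open>If no constant works, the unit vectors \<open>e n\<close> pointing from nearest points
  \<open>p n\<close> of \<open>S\<close> to \<open>z n\<close> accumulate at some \<open>e0\<close>
  with \<open>L e0 = 0\<close>. For a suitable \<open>n\<close>, a small move of \<open>p n\<close>
  along \<open>e0\<close> stays in \<open>S\<close> and comes closer to \<open>z n\<close>, which is
  impossible.\<close>

lemma polyhedral_cone_error_bound:
  fixes W :: "'a::euclidean_space set" and L :: "'a \<Rightarrow> real"
  assumes fin: "finite W" and lin: "linear L"
  shows "\<exists>K\<ge>0. \<forall>z. (\<forall>w\<in>W. w \<bullet> z \<le> 0) \<longrightarrow>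
           (\<exists>z0. (\<forall>w\<in>W. w \<bullet> z0 \<le> 0) \<and> L z0 = 0 \<and> norm (z - z0) \<le> K * \<bar>L z\<bar>)"
proof (rule ccontr)
  assume neg: "\<not> ?thesis"
  define S where "S = {z. (\<forall>w\<in>W. w \<bullet> z \<le> 0) \<and> L z = 0}"
  have "\<exists>z. (\<forall>w\<in>W. w \<bullet> z \<le> 0) \<and> (\<forall>z0\<in>S. norm (z - z0) > real (Suc n) * \<bar>L z\<bar>)" for n
  proof (rule ccontr)
    assume none: "\<not> ?thesis"
    have "real (Suc n) \<ge> 0" by simp
    moreover have "\<exists>z0. (\<forall>w\<in>W. w \<bullet> z0 \<le> 0) \<and> L z0 = 0 \<and> norm (z - z0) \<le> real (Suc n) * \<bar>L z\<bar>"
      if "\<forall>w\<in>W. w \<bullet> z \<le> 0" for z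
      using none that unfolding S_def by (smt (verit) mem_Collect_eq)
    ultimately show False using neg by blast
  qed
  then obtain z where zW: "\<And>n w. w \<in> W \<Longrightarrow> w \<bullet> z n \<le> 0"
    and zS: "\<And>n z0. z0 \<in> S \<Longrightarrow> norm (z n - z0) > real (Suc n) * \<bar>L (z n)\<bar>"
    by metis
  have contL: "continuous_on UNIV L" using lin linear_continuous_on linear_linear by blast
  have "S = (\<Inter>w\<in>W. {z. w \<bullet> z \<le> 0}) \<inter> L -` {0}" by (auto simp: S_def)
  moreover have "closed (L -` {0})" using contL by (simp add: continuous_closed_vimage continuous_on_eq_continuous_at)
  ultimately have clS: "closed S" by (simp add: closed_INT closed_halfspace_le closed_Int)
  have "0 \<in> S" using lin by (simp add: S_def linear_0)
  then have "\<exists>p\<in>S. \<forall>y\<in>S. dist (z n) p \<le> dist (z n) y" for n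
    using distance_attains_inf[OF clS] by (metis empty_iff)
  then obtain p where pS: "\<And>n. p n \<in> S"
    and pmin: "\<And>n y. y \<in> S \<Longrightarrow> norm (z n - p n) \<le> norm (z n - y)"
    unfolding dist_norm by metis
  define r where "r n = norm (z n - p n)" for n
  have rL: "r n > real (Suc n) * \<bar>L (z n)\<bar>" for n unfolding r_def using zS pS by blast
  have rpos: "r n > 0" for n
    using rL[of n] by (smt (verit) mult_nonneg_nonneg of_nat_0_le_iff)
  define e where "e n = (z n - p n) /\<^sub>R r n" for n
  have "e n \<in> sphere 0 1" for n using rpos[of n] by (simp add: e_def r_def)
  then obtain e0 s where e0: "e0 \<in> sphere 0 1" and s: "strict_mono (s::nat\<Rightarrow>nat)" and lim: "(e \<circ> s) \<longlonglongrightarrow> e0"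
    using compact_sphere[of "0::'a" 1] unfolding compact_def by metis
  have zp: "z n = p n + r n *\<^sub>R e n" for n using rpos[of n] by (simp add: e_def)
  \<comment> \<open>\<open>L\<close> vanishes at \<open>p n\<close>, so
    \<open>L (z n) = r n * L (e n)\<close>, and \<open>r n\<close> cancels from
    \<open>rL\<close>.\<close>
  have Le: "\<bar>L (e n)\<bar> \<le> inverse (real (Suc n))" for n
  proof -
    have "L (z n) = r n * L (e n)" using pS[of n] lin
      by (subst zp) (simp add: linear_add linear_scale S_def)
    then have "real (Suc n) * (r n * \<bar>L (e n)\<bar>) < r n" using rL[of n] rpos[of n]
      by (simp add: abs_mult)
    then have "real (Suc n) * \<bar>L (e n)\<bar> < 1" using rpos[of n]
      by (smt (verit, best) mult.left_commute mult_le_cancel_left1)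
    then show ?thesis by (simp add: field_simps)
  qed
  have "(\<lambda>n. L (e n)) \<longlonglongrightarrow> 0"
    by (rule Lim_null_comparison[OF _ LIMSEQ_inverse_real_of_nat]) (use Le in auto)
  then have "(\<lambda>n. L ((e \<circ> s) n)) \<longlonglongrightarrow> 0"
    using LIMSEQ_subseq_LIMSEQ[OF _ s] by (fastforce simp: o_def)
  moreover have "(\<lambda>n. L ((e \<circ> s) n)) \<longlonglongrightarrow> L e0"
    using contL lim by (metis UNIV_I continuous_on_eq_continuous_at isCont_tendsto_compose open_UNIV)
  ultimately have Le0: "L e0 = 0" using LIMSEQ_unique by blast
  have "\<forall>\<^sub>F n in sequentially. w \<bullet> e0 > 0 \<longrightarrow> w \<bullet> (e \<circ> s) n > 0" for w
    using order_tendstoD(1)[OF tendsto_inner[OF tendsto_const lim], of 0 w]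
    by (cases "w \<bullet> e0 > 0") auto
  then have "\<forall>\<^sub>F n in sequentially. \<forall>w\<in>W. w \<bullet> e0 > 0 \<longrightarrow> w \<bullet> (e \<circ> s) n > 0"
    using fin by (simp add: eventually_ball_finite)
  moreover have "\<forall>\<^sub>F n in sequentially. (e \<circ> s) n \<bullet> e0 > 0"
    using order_tendstoD(1)[OF tendsto_inner[OF lim tendsto_const], of 0 e0] e0
    by (cases "e0 = 0") auto
  \<comment> \<open>By finiteness of \<open>W\<close> one index serves all constraints at once; only
    this index is used below.\<close>
  ultimately obtain m where act: "\<And>w. w \<in> W \<Longrightarrow> w \<bullet> e0 > 0 \<Longrightarrow> w \<bullet> e (s m) > 0"
    and pos: "e (s m) \<bullet> e0 > 0"
    using eventually_happens[OF eventually_conj] by (fastforce simp: o_def)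
  define n where "n = s m"
  have "\<forall>w\<in>W. \<forall>\<^sub>F h in at_right 0. w \<bullet> (p n + h *\<^sub>R e0) \<le> 0"
  proof
    fix w assume w: "w \<in> W"
    show "\<forall>\<^sub>F h in at_right 0. w \<bullet> (p n + h *\<^sub>R e0) \<le> 0"
    proof (cases "w \<bullet> e0 > 0")
      case True
      \<comment> \<open>A constraint that \<open>e0\<close> would violate is inactive at the nearest point \<open>p n\<close>, so \<open>p n\<close> can be moved towards \<open>e0\<close>.\<close>
      have "w \<bullet> z n = w \<bullet> p n + r n * (w \<bullet> e n)" by (subst zp) (simp add: inner_add_right)
      then have "w \<bullet> p n < 0" using zW[OF w, of n] act[OF w True] rpos[of n]
        by (smt (verit) mult_pos_pos n_def)
      moreover have "((\<lambda>h. w \<bullet> (p n + h *\<^sub>R e0)) \<longlongrightarrow> w \<bullet> (p n + 0 *\<^sub>R e0)) (at_right 0)"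
        by (intro tendsto_intros)
      ultimately have "\<forall>\<^sub>F h in at_right 0. w \<bullet> (p n + h *\<^sub>R e0) < 0"
        by (intro order_tendstoD) auto
      then show ?thesis by (rule eventually_mono) simp
    next
      case False
      show ?thesis using eventually_at_right_less[of "0::real"]
      proof (rule eventually_mono)
        fix h :: real assume "0 < h"
        then have "h * (w \<bullet> e0) \<le> 0" using False by (simp add: mult_le_0_iff)
        then show "w \<bullet> (p n + h *\<^sub>R e0) \<le> 0"
          using pS[of n] w by (auto simp: S_def inner_add_right intro: add_nonpos_nonpos)
      qed
    qed
  qed
  then have "\<forall>\<^sub>F h in at_right 0. \<forall>w\<in>W. w \<bullet> (p n + h *\<^sub>R e0) \<le> 0"
    using fin by (simp add: eventually_ball_finite)
  \<comment> \<open>For positive \<open>h\<close> below this bound, \<open>h^2\<close> is smaller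
    than the cross term \<open>2 * h * ((z n - p n) \<bullet> e0)\<close>, so the move shortens the
    distance to \<open>z n\<close>.\<close>
  moreover have "\<forall>\<^sub>F h in at_right 0. h < 2 * ((z n - p n) \<bullet> e0)"
    by (rule order_tendstoD[OF tendsto_ident_at])
       (use pos rpos[of n] in \<open>simp add: e_def n_def zero_less_mult_iff\<close>)
  ultimately have "\<forall>\<^sub>F h in at_right (0::real). h > 0 \<and> h < 2 * ((z n - p n) \<bullet> e0) \<and> (\<forall>w\<in>W. w \<bullet> (p n + h *\<^sub>R e0) \<le> 0)"
    using eventually_at_right_less by eventually_elim auto
  then obtain h where h: "h > 0" "h < 2 * ((z n - p n) \<bullet> e0)" "\<forall>w\<in>W. w \<bullet> (p n + h *\<^sub>R e0) \<le> 0"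
    using eventually_happens'[OF trivial_limit_at_right_real] by (smt (verit, best))
  have "p n + h *\<^sub>R e0 \<in> S" using h(3) pS[of n] Le0 lin by (simp add: S_def linear_add linear_scale)
  then have "norm (z n - p n) \<le> norm ((z n - p n) - h *\<^sub>R e0)"
    using pmin[of "p n + h *\<^sub>R e0" n] by (simp add: algebra_simps)
  then have "(norm (z n - p n))^2 \<le> (norm ((z n - p n) - h *\<^sub>R e0))^2" by (simp add: power_mono)
  also have "\<dots> = (norm (z n - p n))^2 - h * (2 * ((z n - p n) \<bullet> e0)) + h^2"
    using dot_norm_neg[of "z n - p n" "h *\<^sub>R e0"] e0 by (simp add: power_mult_distrib)
  finally have "2 * ((z n - p n) \<bullet> e0) \<le> h" using h(1) by (simp add: power2_eq_square)
  then show False using h by simp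
qed

section \<open>Symmetric trilinear forms and their diagonal values\<close>

text \<open>Linearity is demanded in the last slot only; the two adjacent transpositions generate
  all permutations and carry it to the other slots.\<close>

definition symmetric_trilinear :: "('a::real_vector \<Rightarrow> 'a \<Rightarrow> 'a \<Rightarrow> real) \<Rightarrow> bool" where
  "symmetric_trilinear F \<longleftrightarrow>
     (\<forall>u v. linear (F u v)) \<and> (\<forall>u v w. F u v w = F v u w) \<and> (\<forall>u v w. F u v w = F u w v)"

lemma symmetric_trilinear_add_scaled:
  assumes "symmetric_trilinear F"
  shows "F (z + t *\<^sub>R d) (z + t *\<^sub>R d) (z + t *\<^sub>R d)
    = F z z z + (3 * F d z z) * t + (3 * F d d z) * t^2 + F d d d * t^3"
proof -
  have l3: "F u v (a + t *\<^sub>R b) = F u v a + t * F u v b" for u v a b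
    using assms by (simp add: symmetric_trilinear_def linear_add linear_scale)
  have s: "F u v w = F v u w" "F u v w = F u w v" for u v w
    using assms by (auto simp: symmetric_trilinear_def)
  have l2: "F u (a + t *\<^sub>R b) w = F u a w + t * F u b w" for u w a b
    by (simp only: s(2)[of u _ w] l3)
  have l1: "F (a + t *\<^sub>R b) u w = F a u w + t * F b u w" for u w a b
    by (simp only: s(1)[of _ u w] l2)
  have e: "F z z d = F d z z" "F z d z = F d z z" "F z d d = F d d z" "F d z d = F d d z"
    by (simp_all only: s(1)[of z d] s(2)[of z z d] s(2)[of d z d])
  show ?thesis
    unfolding l1 l2 l3 e by (simp add: algebra_simps power2_eq_square power3_eq_cube)
qed

lemma symmetric_trilinear_scale:
  assumes F: "symmetric_trilinear F"
  shows "F (t *\<^sub>R v) (t *\<^sub>R v) (t *\<^sub>R v) = t^3 * F v v v"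
proof -
  have "F u w 0 = 0" for u w using F linear_0[of "F u w"] unfolding symmetric_trilinear_def by blast
  then show ?thesis using symmetric_trilinear_add_scaled[OF F, of 0 t v] by simp
qed

lemma symmetric_trilinear_bounded_bilinear:
  fixes F :: "'a::euclidean_space \<Rightarrow> 'a \<Rightarrow> 'a \<Rightarrow> real"
  assumes "symmetric_trilinear F"
  shows "bounded_bilinear (F u)"
proof -
  have "linear (F u v)" "(\<lambda>x. F u x v) = F u v" for v
    using assms by (auto simp: symmetric_trilinear_def)
  then have "bilinear (F u)" by (simp add: bilinear_def)
  then show ?thesis by (simp add: bilinear_conv_bounded_bilinear)
qed

lemma symmetric_trilinear_tendsto_diagonal:
  fixes F :: "'a::euclidean_space \<Rightarrow> 'a \<Rightarrow> 'a \<Rightarrow> real"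
  assumes F: "symmetric_trilinear F" and g: "(g \<longlongrightarrow> l) X"
  shows "((\<lambda>x. F (g x) (g x) (g x)) \<longlongrightarrow> F l l l) X"
proof -
  \<comment> \<open>Bilinear continuity covers two slots, so the first one is expanded over the
    basis, which leaves finitely many terms with a fixed first argument.\<close>
  have exp: "F u v v = (\<Sum>b\<in>Basis. (u \<bullet> b) * F b v v)" for u v
  proof -
    have s: "F u v w = F v u w" "F u v w = F u w v" for u v w
      using F by (auto simp: symmetric_trilinear_def)
    have "F u v v = F v v u" by (simp only: s(1)[of u v v] s(2)[of v u v])
    also have "\<dots> = F v v (\<Sum>b\<in>Basis. (u \<bullet> b) *\<^sub>R b)" by (simp add: euclidean_representation)
    also have "\<dots> = (\<Sum>b\<in>Basis. (u \<bullet> b) * F v v b)"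
      using F by (simp add: symmetric_trilinear_def linear_sum linear_scale)
    also have "\<dots> = (\<Sum>b\<in>Basis. (u \<bullet> b) * F b v v)"
    proof (intro sum.cong refl)
      fix b
      show "(u \<bullet> b) * F v v b = (u \<bullet> b) * F b v v"
        by (simp only: s(2)[of v v b] s(1)[of v b v])
    qed
    finally show ?thesis .
  qed
  show ?thesis
    by (subst (1 2) exp)
       (intro tendsto_intros g bounded_bilinear.tendsto[OF symmetric_trilinear_bounded_bilinear[OF F]])
qed

section \<open>Quadratic against linear coefficient along a direction\<close>

text \<open>As \<open>F d d d = 0\<close>, the increment is
  \<open>3 * t * (F d z z + t * F d d z)\<close>. With \<open>F d d z \<le> 0\<close> it suffices
  that \<open>F d z z \<le> t * \<bar>F d d z\<bar>\<close>, which the error bound yields with one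
  \<open>C\<close> for all of \<open>K\<close>.\<close>

lemma cubic_nonincreasing_along_direction:
  fixes F :: "'a::euclidean_space \<Rightarrow> 'a \<Rightarrow> 'a \<Rightarrow> real" and W :: "'a set"
  defines "K \<equiv> {z. \<forall>w\<in>W. w \<bullet> z \<le> 0}"
  assumes F: "symmetric_trilinear F" and "finite W" and d: "F d d d = 0"
    and bd: "\<And>z. z \<in> K \<Longrightarrow> \<exists>M. \<forall>t\<ge>0. F (z + t *\<^sub>R d) (z + t *\<^sub>R d) (z + t *\<^sub>R d) \<le> M"
  shows "\<exists>C\<ge>0. \<forall>z\<in>K. \<forall>t\<ge>C * norm z.
           F (z + t *\<^sub>R d) (z + t *\<^sub>R d) (z + t *\<^sub>R d) \<le> F z z z"
proof -
  have sgn: "F d d z \<le> 0 \<and> (F d d z = 0 \<longrightarrow> F d z z \<le> 0)" if z: "z \<in> K" for z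
  proof -
    from bd[OF z] obtain M where
      "\<And>t. t \<ge> 0 \<Longrightarrow> F (z + t *\<^sub>R d) (z + t *\<^sub>R d) (z + t *\<^sub>R d) \<le> M" by blast
    then have "\<And>t. t \<ge> 0 \<Longrightarrow> F z z z + (3 * F d z z) * t + (3 * F d d z) * t^2 + 0 * t^3 \<le> M"
      using symmetric_trilinear_add_scaled[OF F, of z _ d] d by simp
    from cubic_bounded_above_coeffs(2,3)[OF this] show ?thesis by simp
  qed
  interpret bounded_bilinear "F d" by (rule symmetric_trilinear_bounded_bilinear[OF F])
  obtain B where B: "B \<ge> 0" "\<And>u v. \<bar>F d u v\<bar> \<le> norm u * norm v * B"
    using nonneg_bounded by (auto simp: real_norm_def)
  have "linear (F d d)" using F by (simp add: symmetric_trilinear_def)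
  from polyhedral_cone_error_bound[OF \<open>finite W\<close> this] obtain H where H: "H \<ge> 0"
    "\<And>z. z \<in> K \<Longrightarrow> \<exists>z0\<in>K. F d d z0 = 0 \<and> norm (z - z0) \<le> H * \<bar>F d d z\<bar>"
    unfolding K_def by blast
  \<comment> \<open>Three factors: \<open>B\<close> bounds the bilinear map \<open>F d\<close>,
    \<open>H\<close> bounds the distance to the subcone in units of
    \<open>\<bar>F d d z\<bar>\<close>, and the bracket bounds \<open>norm z + norm z0\<close> in
    units of \<open>norm z\<close>.\<close>
  define C where "C = B * H * (2 + H * B * norm d)"
  have C: "C \<ge> 0" using B H by (simp add: C_def)
  have key: "F d z z \<le> C * norm z * \<bar>F d d z\<bar>" if z: "z \<in> K" for z
  proof -
    define q where "q = \<bar>F d d z\<bar>"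
    obtain z0 where z0: "z0 \<in> K" "F d d z0 = 0" "norm (z - z0) \<le> H * q"
      using H(2)[OF z] unfolding q_def by blast
    have q: "q \<ge> 0" "q \<le> norm d * norm z * B" using B(2)[of d z] by (auto simp: q_def)
    have "norm z0 \<le> norm z + norm (z - z0)" by (metis norm_triangle_sub norm_minus_commute)
    also have "\<dots> \<le> norm z + H * (norm d * norm z * B)"
      using z0(3) mult_left_mono[OF q(2) H(1)] by linarith
    finally have n0: "norm z + norm z0 \<le> (2 + H * B * norm d) * norm z" by (simp add: algebra_simps)
    \<comment> \<open>Replace \<open>z\<close> by \<open>z0\<close> one slot at a time;
      \<open>F d z0 z0 \<le> 0\<close> because \<open>F d d z0 = 0\<close>.\<close>
    have "F d z z = F d z0 z0 + F d z (z - z0) + F d (z - z0) z0"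
      by (simp add: diff_left diff_right)
    also have "\<dots> \<le> norm z * norm (z - z0) * B + norm (z - z0) * norm z0 * B"
      using sgn[OF z0(1)] z0(2) B(2)[of z "z - z0"] B(2)[of "z - z0" z0] by linarith
    also have "\<dots> = B * norm (z - z0) * (norm z + norm z0)" by (simp add: algebra_simps)
    also have "\<dots> \<le> B * (H * q) * ((2 + H * B * norm d) * norm z)"
      using B H q z0(3) n0 by (intro mult_mono) auto
    finally show ?thesis by (simp add: C_def q_def mult_ac)
  qed
  have "F (z + t *\<^sub>R d) (z + t *\<^sub>R d) (z + t *\<^sub>R d) \<le> F z z z"
    if z: "z \<in> K" and t: "t \<ge> C * norm z" for z t
  proof -
    have t0: "t \<ge> 0" using t C by (meson mult_nonneg_nonneg norm_ge_zero order_trans)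
    have "F d z z \<le> t * \<bar>F d d z\<bar>" using key[OF z] mult_right_mono[OF t, of "\<bar>F d d z\<bar>"] by simp
    also have "\<dots> = - (F d d z * t)" using sgn[OF z] by simp
    finally have "(F d z z + F d d z * t) * t \<le> 0" using t0 by (simp add: mult_le_0_iff)
    then show ?thesis
      using symmetric_trilinear_add_scaled[OF F, of z t d] d by (simp add: algebra_simps power2_eq_square)
  qed
  then show ?thesis using C by blast
qed

section \<open>Homogenizing the polynomial, and describing the polyhedron by inequalities\<close>

lemma poly_deg_le3_homogenization:
  fixes f :: "real ^ 'n \<Rightarrow> real"
  assumes "poly_deg_le3 f"
  shows "\<exists>F :: (real ^ 'n) \<times> real \<Rightarrow> _. symmetric_trilinear F \<and> (\<forall>x. f x = F (x, 1) (x, 1) (x, 1))"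
proof -
  obtain c b A T where f: "\<And>x. f x = c + (\<Sum>i\<in>UNIV. b i * x $ i)
                   + (\<Sum>i\<in>UNIV. \<Sum>j\<in>UNIV. A i j * x $ i * x $ j)
                   + (\<Sum>i\<in>UNIV. \<Sum>j\<in>UNIV. \<Sum>k\<in>UNIV. T i j k * x $ i * x $ j * x $ k)"
    using assms unfolding poly_deg_le3_def by blast
  \<comment> \<open>Terms of degree below three get their missing factors from the last coordinate,
    which is 1 at \<open>(x, 1)\<close>.\<close>
  define B :: "(real ^ 'n) \<times> real \<Rightarrow> (real ^ 'n) \<times> real \<Rightarrow> (real ^ 'n) \<times> real \<Rightarrow> real" where
    "B u v w = c * snd u * snd v * snd w + (\<Sum>i\<in>UNIV. b i * fst u $ i * snd v * snd w)
       + (\<Sum>i\<in>UNIV. \<Sum>j\<in>UNIV. A i j * fst u $ i * fst v $ j * snd w)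
       + (\<Sum>i\<in>UNIV. \<Sum>j\<in>UNIV. \<Sum>k\<in>UNIV. T i j k * fst u $ i * fst v $ j * fst w $ k)" for u v w
  have l1: "linear (\<lambda>x. B x u v)" for u v
    by (rule linearI) (simp_all add: B_def algebra_simps sum.distrib sum_distrib_left)
  have l2: "linear (\<lambda>x. B u x v)" for u v
    by (rule linearI) (simp_all add: B_def algebra_simps sum.distrib sum_distrib_left)
  have l3: "linear (\<lambda>x. B u v x)" for u v
    by (rule linearI) (simp_all add: B_def algebra_simps sum.distrib sum_distrib_left)
  \<comment> \<open>Averaging over the six argument orders symmetrizes \<open>B\<close> and keeps
    its diagonal values.\<close>
  define F where "F u v w = (B u v w + B u w v + B v u w + B v w u + B w u v + B w v u) / 6" for u v w
  have "linear (F u v)" for u v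
    by (rule linearI)
       (simp_all add: F_def linear_add[OF l1] linear_add[OF l2] linear_add[OF l3]
          linear_scale[OF l1] linear_scale[OF l2] linear_scale[OF l3] field_simps)
  moreover have "F u v w = F v u w" "F u v w = F u w v" for u v w by (simp_all add: F_def)
  moreover have "f x = F (x, 1) (x, 1) (x, 1)" for x by (simp add: F_def B_def f)
  ultimately show ?thesis unfolding symmetric_trilinear_def by blast
qed

lemma polyhedron_inequalities:
  assumes "polyhedron P"
  obtains I where "finite I" "P = {x. \<forall>(a, b)\<in>I. a \<bullet> x \<le> b}"
proof -
  obtain H where H: "finite H" "P = \<Inter>H" "\<forall>h\<in>H. \<exists>a b. a \<noteq> 0 \<and> h = {x. a \<bullet> x \<le> b}"
    using assms unfolding polyhedron_def by blast
  then obtain a b where ab: "\<And>h. h \<in> H \<Longrightarrow> h = {x. a h \<bullet> x \<le> b h}" by metis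
  have "P = {x. \<forall>(a, b)\<in>(\<lambda>h. (a h, b h)) ` H. a \<bullet> x \<le> b}" using H(2) ab by auto
  with H(1) show ?thesis using that by blast
qed

theorem theorem7:
  fixes P :: "(real ^ 'n) set" and f :: "real ^ 'n \<Rightarrow> real"
  assumes "polyhedron P"
    and "poly_deg_le3 f"
    and "unbounded_on f P"
  shows "\<exists>x\<in>P. \<exists>d\<in>rec_cone P - {0}. unbounded_on f (ray x d)"
proof (rule ccontr)
  assume no_ray: "\<not> ?thesis"

  \<comment> \<open>The cone over \<open>P\<close> and the bounds along its rays\<close>
  obtain F :: "(real ^ 'n) \<times> real \<Rightarrow> (real ^ 'n) \<times> real \<Rightarrow> (real ^ 'n) \<times> real \<Rightarrow> real"
    where F: "symmetric_trilinear F" and fF: "\<And>x. f x = F (x, 1) (x, 1) (x, 1)"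
    using poly_deg_le3_homogenization[OF assms(2)] by blast
  obtain I where I: "finite I" "P = {x. \<forall>(a, b)\<in>I. a \<bullet> x \<le> b}"
    using polyhedron_inequalities[OF assms(1)] by blast
  \<comment> \<open>\<open>(a, - b)\<close> encodes \<open>a \<bullet> x \<le> b * s\<close> and
    \<open>(0, - 1)\<close> encodes \<open>s \<ge> 0\<close>, so the slice of \<open>K\<close> at
    height 1 is \<open>P\<close>, and the slice at height 0 consists of recession
    directions.\<close>
  define W where "W = insert (0, - 1) ((\<lambda>(a, b). (a, - b)) ` I)"
  define K where "K = {z. \<forall>w\<in>W. w \<bullet> z \<le> 0}"
  have K: "(x, s) \<in> K \<longleftrightarrow> s \<ge> 0 \<and> (\<forall>(a, b)\<in>I. a \<bullet> x \<le> b * s)" for x s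
    by (auto simp: K_def W_def)
  have rec: "d \<in> rec_cone P" if "\<forall>(a, b)\<in>I. a \<bullet> d \<le> 0" for d
    unfolding rec_cone_def
  proof (intro CollectI ballI allI impI)
    fix x and t :: real assume x: "x \<in> P" and t: "t \<ge> 0"
    show "x + t *\<^sub>R d \<in> P" unfolding I(2)
    proof (clarify)
      fix a b assume ab: "(a, b) \<in> I"
      have "t * (a \<bullet> d) \<le> 0" using that ab t by (auto simp: mult_le_0_iff)
      moreover have "a \<bullet> x \<le> b" using x ab by (auto simp: I(2))
      ultimately show "a \<bullet> (x + t *\<^sub>R d) \<le> b" by (simp add: inner_add_right)
    qed
  qed
  have ray_bd: "\<exists>M. \<forall>t\<ge>0. f (x + t *\<^sub>R d) \<le> M" if "x \<in> P" "d \<in> rec_cone P" for x d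
  proof (cases "d = 0")
    case False
    with no_ray that have "\<not> unbounded_on f (ray x d)" by blast
    then obtain M where "\<And>y. y \<in> ray x d \<Longrightarrow> f y \<le> M"
      unfolding unbounded_on_def not_all not_less by (auto simp: not_less)
    then show ?thesis by (auto simp: ray_def)
  qed auto
  obtain x0 where x0: "x0 \<in> P" using assms(3) by (auto simp: unbounded_on_def)
  have hom: "F (x + t *\<^sub>R d, 1) (x + t *\<^sub>R d, 1) (x + t *\<^sub>R d, 1)
      = F (x, 1) (x, 1) (x, 1) + (3 * F (d, 0) (x, 1) (x, 1)) * t + (3 * F (d, 0) (d, 0) (x, 1)) * t^2
        + F (d, 0) (d, 0) (d, 0) * t^3" for x d t
    using symmetric_trilinear_add_scaled[OF F, of "(x, 1)" t "(d, 0)"] by simp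
  have lead: "F (d, 0) (d, 0) (d, 0) \<le> 0" if "d \<in> rec_cone P" for d
  proof -
    obtain M where "\<And>t. t \<ge> 0 \<Longrightarrow> f (x0 + t *\<^sub>R d) \<le> M" using ray_bd[OF x0 \<open>d \<in> rec_cone P\<close>] by blast
    then show ?thesis unfolding fF hom by (rule cubic_bounded_above_coeffs(1))
  qed

  \<comment> \<open>Points of least norm in high superlevel sets\<close>
  have contf: "continuous_on S f" for S
    unfolding fF continuous_on_def
    by (intro ballI symmetric_trilinear_tendsto_diagonal[OF F] tendsto_intros)
  have "\<exists>x\<in>P. norm x \<ge> real (Suc n) \<and> f x > 0 \<and> (\<forall>y\<in>P. f y \<ge> f x \<longrightarrow> norm x \<le> norm y)" for n
  proof -
    have "bounded (f ` cball 0 (real (Suc n)))"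
      by (intro compact_imp_bounded compact_continuous_image contf compact_cball)
    then obtain M where M: "\<And>x. norm x \<le> real (Suc n) \<Longrightarrow> f x \<le> M"
      unfolding bounded_iff by (force simp: abs_le_iff)
    \<comment> \<open>Exceeding \<open>M\<close> puts the superlevel set of \<open>f v\<close>
      outside the ball; exceeding 0 fixes the sign of the cubic form in the limit. A point
      \<open>x\<close> of least norm in this set is also one in the smaller superlevel set of
      \<open>f x\<close>.\<close>
    obtain v where v: "v \<in> P" "f v > max M 0" using assms(3) unfolding unbounded_on_def by blast
    have "closed {y \<in> P. f y \<ge> f v}"
      using continuous_closed_preimage[OF contf polyhedron_imp_closed[OF assms(1)], of "{f v..}"]
      by (simp add: vimage_def Int_def)
    moreover have "{y \<in> P. f y \<ge> f v} \<noteq> {}" using v(1) by blast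
    ultimately obtain x where x: "x \<in> {y \<in> P. f y \<ge> f v}" "\<And>y. y \<in> {y \<in> P. f y \<ge> f v} \<Longrightarrow> dist 0 x \<le> dist 0 y"
      using distance_attains_inf[of _ 0] by blast
    have "norm x > real (Suc n)" using M[of x] v(2) x(1) by force
    moreover have "\<forall>y\<in>P. f y \<ge> f x \<longrightarrow> norm x \<le> norm y" using x by fastforce
    ultimately show ?thesis using x(1) v(2) by (intro bexI[of _ x]) auto
  qed
  then obtain x where xP: "\<And>n. x n \<in> P" and xn: "\<And>n. norm (x n) \<ge> real (Suc n)"
    and fx: "\<And>n. f (x n) > 0" and xmin: "\<And>n y. y \<in> P \<Longrightarrow> f y \<ge> f (x n) \<Longrightarrow> norm (x n) \<le> norm y"
    by metis
  have xpos: "norm (x n) > 0" for n using xn[of n] by linarith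

  \<comment> \<open>The limit direction of these points\<close>
  then have unit: "\<forall>n. x n /\<^sub>R norm (x n) \<in> sphere 0 1" by simp
  obtain d s where d: "d \<in> sphere 0 1" and s: "strict_mono (s::nat\<Rightarrow>nat)"
    and lim0: "((\<lambda>n. x n /\<^sub>R norm (x n)) \<circ> s) \<longlonglongrightarrow> d"
    using seq_compactE[OF compact_imp_seq_compact[OF compact_sphere] unit] by blast
  define N where "N n = norm (x (s n))" for n
  define u where "u n = x (s n) /\<^sub>R N n" for n
  have lim: "u \<longlonglongrightarrow> d" using lim0 by (simp add: u_def[abs_def] N_def o_def)
  have Npos: "N n > 0" for n using xpos by (simp add: N_def)
  have xu: "x (s n) = N n *\<^sub>R u n" for n using Npos[of n] by (simp add: u_def)
  have "real n \<le> N n" for n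
    using xn[of "s n"] strict_mono_imp_increasing[OF s, of n] by (simp add: N_def)
  then have Ninf: "filterlim N at_top sequentially"
    by (intro filterlim_at_top_mono[OF filterlim_real_sequentially]) auto
  have lim1: "(\<lambda>n. inverse (N n)) \<longlonglongrightarrow> 0"
    by (rule tendsto_inverse_0_at_top[OF Ninf])
  have ad: "a \<bullet> d \<le> 0" if ab: "(a, b) \<in> I" for a b
  proof (rule LIMSEQ_le)
    show "(\<lambda>n. a \<bullet> u n) \<longlonglongrightarrow> a \<bullet> d" by (intro tendsto_intros lim)
    show "(\<lambda>n. b * inverse (N n)) \<longlonglongrightarrow> 0" using tendsto_mult[OF tendsto_const lim1, of b] by simp
    have "a \<bullet> u n \<le> b * inverse (N n)" for n
      using xP[of "s n"] ab Npos[of n] by (auto simp: I(2) u_def field_simps)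
    then show "\<exists>k. \<forall>n\<ge>k. a \<bullet> u n \<le> b * inverse (N n)" by blast
  qed
  have dP: "d \<in> rec_cone P" using rec ad by blast
  \<comment> \<open>Scaling \<open>(x (s n), 1)\<close> by \<open>inverse (N n)\<close> gives points
    tending to \<open>(d, 0)\<close>, where the form equals a positive multiple of
    \<open>f (x (s n))\<close>.\<close>
  have "F (d, 0) (d, 0) (d, 0) \<ge> 0"
  proof (rule LIMSEQ_le_const)
    show "(\<lambda>n. F (u n, inverse (N n)) (u n, inverse (N n)) (u n, inverse (N n)))
        \<longlonglongrightarrow> F (d, 0) (d, 0) (d, 0)"
      by (intro symmetric_trilinear_tendsto_diagonal[OF F] tendsto_intros lim lim1)
    have "F (u n, inverse (N n)) (u n, inverse (N n)) (u n, inverse (N n)) = inverse (N n)^3 * f (x (s n))" for n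
      using symmetric_trilinear_scale[OF F, of "inverse (N n)" "(x (s n), 1)"] by (simp add: u_def fF)
    then show "\<exists>k. \<forall>n\<ge>k. 0 \<le> F (u n, inverse (N n)) (u n, inverse (N n)) (u n, inverse (N n))"
      using fx Npos by (simp add: less_imp_le)
  qed
  then have d0: "F (d, 0) (d, 0) (d, 0) = 0" using lead[OF dP] by simp

  \<comment> \<open>Descent along \<open>d\<close> on the whole cone\<close>
  have "\<exists>M. \<forall>t\<ge>0. F (z + t *\<^sub>R (d, 0)) (z + t *\<^sub>R (d, 0)) (z + t *\<^sub>R (d, 0)) \<le> M"
    if zK: "z \<in> K" for z
  proof -
    obtain y r where z: "z = (y, r)" by fastforce
    with zK have r: "r \<ge> 0" and y: "\<And>a b. (a, b) \<in> I \<Longrightarrow> a \<bullet> y \<le> b * r" by (auto simp: K)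
    show ?thesis
    \<comment> \<open>At height 0 the ray runs through recession directions and \<open>lead\<close>
      gives the bound 0. At height \<open>r > 0\<close>, division by \<open>r\<close> leads into
      \<open>P\<close>, at the cost of a factor \<open>r^3\<close> and of time
      \<open>t / r\<close>.\<close>
    proof (cases "r = 0")
      case True
      have "F (y + t *\<^sub>R d, 0) (y + t *\<^sub>R d, 0) (y + t *\<^sub>R d, 0) \<le> 0" if "t \<ge> 0" for t
      proof (intro lead rec, clarify)
        fix a b assume ab: "(a, b) \<in> I"
        have "t * (a \<bullet> d) \<le> 0" using ad[OF ab] that by (simp add: mult_le_0_iff)
        then show "a \<bullet> (y + t *\<^sub>R d) \<le> 0" using y[OF ab] True by (simp add: inner_add_right)
      qed
      then show ?thesis using z True by auto
    next
      case False
      with r have rpos: "r > 0" by simp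
      have "y /\<^sub>R r \<in> P" using y rpos by (auto simp: I(2) field_simps)
      from ray_bd[OF this dP] obtain M where M: "\<And>t. t \<ge> 0 \<Longrightarrow> f (y /\<^sub>R r + t *\<^sub>R d) \<le> M" by blast
      have "F (z + t *\<^sub>R (d, 0)) (z + t *\<^sub>R (d, 0)) (z + t *\<^sub>R (d, 0)) \<le> r^3 * M" if "t \<ge> 0" for t
      proof -
        define v where "v = (y /\<^sub>R r + (t / r) *\<^sub>R d, 1::real)"
        have "z + t *\<^sub>R (d, 0) = r *\<^sub>R v"
          using rpos by (simp add: z v_def scaleR_add_right)
        moreover have "F v v v \<le> M" using M[of "t / r"] that rpos by (simp add: fF v_def)
        ultimately show ?thesis
          using symmetric_trilinear_scale[OF F, of r v] rpos by simp
      qed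
      then show ?thesis by blast
    qed
  qed
  then obtain C where C: "C \<ge> 0" and desc: "\<And>z t. z \<in> K \<Longrightarrow> t \<ge> C * norm z \<Longrightarrow>
      F (z + t *\<^sub>R (d, 0)) (z + t *\<^sub>R (d, 0)) (z + t *\<^sub>R (d, 0)) \<le> F z z z"
    using cubic_nonincreasing_along_direction[OF F, of W "(d, 0)"] I(1) d0
    unfolding K_def W_def by blast

  \<comment> \<open>A shorter point of \<open>P\<close> with at least the same value\<close>
  \<comment> \<open>Below, \<open>norm (z n, 1)\<close> is at most \<open>3 * e * N n\<close> and
    the step back to \<open>x (s n)\<close> has length \<open>(1 - e) * N n\<close>. Descent thus
    needs \<open>3 * C * e \<le> 1 - e\<close>, and here \<open>1 - e = e * (4 * C + 3)\<close>.
    Also \<open>2 * e < 1\<close>.\<close>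
  define e where "e = inverse (4 * (C + 1))"
  have e: "e > 0" "e * (4 * (C + 1)) = 1" using C by (auto simp: e_def)
  define z where "z n = x (s n) - ((1 - e) * N n) *\<^sub>R d" for n
  \<comment> \<open>If \<open>a \<bullet> d = 0\<close>, the constraint has the same value at
    \<open>z n\<close> as at \<open>x (s n)\<close>. Otherwise the coefficient of \<open>N n\<close>
    tends to \<open>e * (a \<bullet> d) < 0\<close>, so \<open>a \<bullet> z n\<close> tends to
    minus infinity.\<close>
  have "\<forall>\<^sub>F n in sequentially. a \<bullet> z n \<le> b" if ab: "(a, b) \<in> I" for a b
  proof (cases "a \<bullet> d = 0")
    case True
    moreover have "a \<bullet> x (s n) \<le> b" for n using xP[of "s n"] ab by (auto simp: I(2))
    ultimately show ?thesis by (simp add: z_def inner_diff_right)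
  next
    case False
    with ad[OF ab] have "a \<bullet> d < 0" by simp
    then have neg: "a \<bullet> d - (1 - e) * (a \<bullet> d) < 0" using e by (simp add: algebra_simps mult_pos_neg)
    have "filterlim (\<lambda>n. (a \<bullet> u n - (1 - e) * (a \<bullet> d)) * N n) at_bot sequentially"
      by (rule filterlim_tendsto_neg_mult_at_bot[OF _ neg Ninf]) (intro tendsto_intros lim)
    moreover have "a \<bullet> z n = (a \<bullet> u n - (1 - e) * (a \<bullet> d)) * N n" for n
      by (simp add: z_def xu inner_diff_right algebra_simps)
    ultimately show ?thesis by (simp add: filterlim_at_bot)
  qed
  then have "\<forall>\<^sub>F n in sequentially. \<forall>(a, b)\<in>I. a \<bullet> z n \<le> b"
    using I(1) by (intro eventually_ball_finite) auto
  moreover have "\<forall>\<^sub>F n in sequentially. dist (u n) d < e" using lim e(1) by (rule tendstoD)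
  moreover have "\<forall>\<^sub>F n in sequentially. inverse e \<le> N n"
    using Ninf by (simp add: filterlim_at_top)
  ultimately have "\<forall>\<^sub>F n in sequentially. z n \<in> P \<and> dist (u n) d < e \<and> inverse e \<le> N n"
    by eventually_elim (auto simp: I(2))
  then obtain n where n: "z n \<in> P" "norm (u n - d) < e" "inverse e \<le> N n"
    using eventually_happens'[OF sequentially_bot] by (auto simp: dist_norm)
  \<comment> \<open>This absorbs the last coordinate 1 in the norm of
    \<open>(z n, 1)\<close>.\<close>
  have eN: "e * N n \<ge> 1" using n(3) e(1) by (simp add: field_simps)
  have "z n = N n *\<^sub>R (u n - d) + (e * N n) *\<^sub>R d" by (simp add: z_def xu algebra_simps)
  then have "norm (z n) \<le> N n * norm (u n - d) + e * N n * norm d"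
    using norm_triangle_ineq[of "N n *\<^sub>R (u n - d)" "(e * N n) *\<^sub>R d"] Npos[of n] e(1) by simp
  also have "\<dots> \<le> 2 * (e * N n)" using d n(2) Npos[of n] by simp
  finally have nz: "norm (z n) \<le> 2 * (e * N n)" .
  have "norm (z n, 1::real) \<le> 3 * (e * N n)" using norm_Pair_le[of "z n" "1::real"] nz eN by simp
  then have "C * norm (z n, 1::real) \<le> C * (3 * (e * N n))" using C by (rule mult_left_mono)
  also have "\<dots> \<le> (e * (4 * (C + 1)) - e) * N n"
    using e(1) C Npos[of n] by (simp add: algebra_simps)
  finally have big: "C * norm (z n, 1::real) \<le> (1 - e) * N n" using e(2) by simp
  have "(z n, 1) \<in> K" using n(1) by (auto simp: K I(2))
  \<comment> \<open>The step \<open>(1 - e) * N n\<close> along \<open>d\<close> leads from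
    \<open>z n\<close> back to \<open>x (s n)\<close>; minimality then contradicts
    \<open>norm (z n) \<le> 2 * e * N n < N n\<close>.\<close>
  from desc[OF this big] have "f (x (s n)) \<le> f (z n)" by (simp add: fF z_def)
  then have "N n \<le> norm (z n)" unfolding N_def using xmin n(1) by blast
  moreover have "e * C \<ge> 0" using e(1) C by simp
  then have "2 * e < 1" using e by (simp add: algebra_simps)
  then have "(2 * e) * N n < 1 * N n" using Npos[of n] by (rule mult_strict_right_mono)
  ultimately show False using nz by simp
qed

end
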